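(* Assume that the eigenvalues $\lambda_1,\dots,\lambda_m$ of $T(\cdot)$ in $\mathcal{D}$ are simple with linearly independent unit eigenvectors $u_1,\dots,u_m$, and let $\mathcal{U}_{\mathcal{D}}=\operatorname{span}\{u_1,\dots,u_m\}$. Suppose the eigenpair extraction procedure satisfies the Extraction Assumption (stated in the context) with constant $\epsilon_T$. Let $\mathcal{X}\subset\mathbb{C}^n$ be an $m$-dimensional subspace with $\epsilon:=\angle(\mathcal{X},\mathcal{U}_{\mathcal{D}})\le\epsilon_T$, and let $(\rho_i,x_i)$, $i=1,\dots,m$, be the approximate eigenpairs extracted from $\mathcal{X}$, with $x_i$ normalized by $e_i^{\mathsf{H}}U^{-1}x_i=1$. Assume there is a family of filters $F_{\mathsf{it}}^{[N]}(\cdot)$, $N=1,2,\dots$, such that the vectors $\widehat{x}_i:=F_{\mathsf{it}}^{[N]}(\rho_i)x_i$, decomposed as $$\widehat{x}_i=\widehat{\alpha}_iu_i+U_{-i}\widehat{y}_i+U_{\mathsf{out}}\widehat{z}_i,$$ satisfy $$|\widehat{\alpha}_i-1|=\mathcal{O}(\gamma_N+\epsilon),\qquad \|\widehat{y}_i\|=\mathcal{O}(\gamma_N+\epsilon),\qquad \|\widehat{z}_i\|=\mathcal{O}(\gamma_N\epsilon),\qquad i=1,\dots,m,$$ with $\gamma_N\ge0$ and $\gamma_N\to0$ as $N\to\infty$. Then the updated subspace $\widehat{\mathcal{X}}=\operatorname{span}\{\widehat{x}_1,\dots,\widehat{x}_m\}$ satisfies $$\widehat{\epsilon}:=\angle(\widehat{\mathcal{X}},\mathcal{U}_{\mathcal{D}})=\mathcal{O}(\gamma_N\epsilon),$$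 where the constants in $\mathcal{O}(\cdot)$ are independent of the choice of $\mathcal{X}$. (The statement is asymptotic in the filter quality: it is understood for $\epsilon_T$ sufficiently small and all sufficiently large $N$, both uniformly in $\mathcal{X}$.)
   Context: Setting: $\mathcal{D}\subset\mathbb{C}$ is a nonempty domain enclosed by a Jordan curve; $T(\cdot)$ is an $n\times n$ holomorphic matrix-valued function on some domain containing the closure of $\mathcal{D}$, with $\det T(\xi_0)\ne0$ for some $\xi_0\in\mathcal{D}$. An eigenpair $(\lambda,u)$ satisfies $T(\lambda)u=0$, $u\neq0$; $\lambda$ is simple if it is a simple zero of $\det T$. $\lambda_1,\dots,\lambda_m$ are all the eigenvalues in $\mathcal{D}$, and $T(\lambda_i)u_i=0$, $\|u_i\|=1$. Notation: $\|\cdot\|$ is the Euclidean/spectral norm; $\angle(\cdot,\cdot)$ is the largest principal angle between two subspaces (or between the ranges of two matrices or vectors). $\mathcal{O}(\cdot)$ absorbs constants depending only on $T(\cdot):\mathcal{D}\to\mathbb{C}^{n\times n}$; in particular they are independent of $\mathcal{X}$ and $N$. Extraction: an extraction procedure assigns to an $m$-dimensional subspace $\mathcal{X}\subset\mathbb{C}^n$ approximate eigenpairs $(\rho_i,x_i)$, $i=1,\dots,m$, with $\rho_i\in\mathcal{D}$ and $0\neq x_i\in\mathcal{X}$. Extraction Assumption: there is a sufficiently small constant $0<\epsilon_T<\pi/2$ depending only on $T(\cdot):\mathcal{D}\to\mathbb{C}^{n\times n}$ such that for every $m$-dimensional subspace $\mathcal{X}$ with $\epsilon=\angle(\mathcal{X},\mathcal{U}_{\mathcal{D}})\le\epsilon_T$,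 the extracted pairs, appropriately ordered, satisfy $|\rho_i-\lambda_i|=\mathcal{O}(\epsilon)$ and $\angle(x_i,u_i)=\mathcal{O}(\epsilon)$ for $i=1,\dots,m$, with constants independent of $\mathcal{X}$. Decomposition: $U_{\mathcal{D}}=[u_1,\dots,u_m]$; $U_{\mathsf{out}}$ is a fixed matrix whose columns form an orthonormal basis of the orthogonal complement of $\mathcal{U}_{\mathcal{D}}$; $U=[U_{\mathcal{D}},U_{\mathsf{out}}]\in\mathbb{C}^{n\times n}$ (invertible); $U_{-i}=[u_1,\dots,u_{i-1},u_{i+1},\dots,u_m]$; $e_i$ is the $i$th unit vector. With the normalization $e_i^{\mathsf{H}}U^{-1}x_i=1$ (possible for $\epsilon_T$ sufficiently small) one has $x_i=u_i+U_{-i}y_i+U_{\mathsf{out}}z_i$. Filters: for each positive integer $N$, $F_{\mathsf{it}}^{[N]}$ is an $n\times n$ matrix-valued function of $\rho\in\mathcal{D}$. The quantities $\widehat\alpha_i\in\mathbb{C},\widehat y_i\in\mathbb{C}^{m-1},\widehat z_i\in\mathbb{C}^{n-m}$ depend on $N$ (suppressed), and the filter bounds hold with constants uniform over the admissible $\mathcal{X}$ and over $N$. *)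

theory Defs
  imports "HOL-Complex_Analysis.Complex_Analysis"
begin

text \<open>The Hermitian inner product; the library's \<^const>\<open>inner\<close> on \<^typ>\<open>complex^'n\<close> is its
  real part.\<close>

definition herm :: "complex^'n \<Rightarrow> complex^'n \<Rightarrow> complex" where
  "herm v w = (\<Sum>i\<in>UNIV. cnj (v $ i) * w $ i)"

text \<open>Recursive (Bjoerck--Golub) definition: \<open>x k\<close>, \<open>y k\<close> are unit vectors that maximize
  \<open>\<bar>x\<^sup>H y\<bar>\<close> over \<open>X\<close>, \<open>Y\<close> subject to orthogonality to the previously chosen vectors; the
  \<open>k\<close>-th principal angle is the arc cosine of that maximum. Subspaces are over \<open>\<complex>\<close>, hence
  the constants qualified by \<open>vec\<close> below.\<close>

definition principal_vectors ::
  "(complex^'n) set \<Rightarrow> (complex^'n) set \<Rightarrow> nat \<Rightarrow> (nat \<Rightarrow> complex^'n) \<Rightarrow> (nat \<Rightarrow> complex^'n) \<Rightarrow> bool"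
  where
  "principal_vectors X Y q x y \<longleftrightarrow>
     (\<forall>k<q. x k \<in> X \<and> y k \<in> Y \<and> norm (x k) = 1 \<and> norm (y k) = 1
        \<and> (\<forall>j<k. herm (x j) (x k) = 0 \<and> herm (y j) (y k) = 0)
        \<and> (\<forall>v\<in>X. \<forall>w\<in>Y. norm v = 1 \<longrightarrow> norm w = 1
              \<longrightarrow> (\<forall>j<k. herm (x j) v = 0 \<and> herm (y j) w = 0)
              \<longrightarrow> cmod (herm v w) \<le> cmod (herm (x k) (y k))))"

text \<open>The largest angle is the last one. Principal vectors exist by compactness; they are not
  unique, but the angles are (their cosines are the singular values of \<open>Q\<^sub>X\<^sup>H Q\<^sub>Y\<close> for
  orthonormal bases \<open>Q\<^sub>X\<close>, \<open>Q\<^sub>Y\<close>), so the choice is immaterial. The value 0 for a zero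
  subspace is a convention.\<close>

definition max_principal_angle :: "(complex^'n) set \<Rightarrow> (complex^'n) set \<Rightarrow> real" where
  "max_principal_angle X Y =
     (let q = min (vec.dim X) (vec.dim Y) in
      if q = 0 then 0
      else (SOME \<theta>. \<exists>x y. principal_vectors X Y q x y
                         \<and> \<theta> = arccos (cmod (herm (x (q - 1)) (y (q - 1))))))"

definition vec_angle :: "complex^'n \<Rightarrow> complex^'n \<Rightarrow> real" where
  "vec_angle v w = max_principal_angle (vec.span {v}) (vec.span {w})"

definition jordan_domain :: "complex set \<Rightarrow> bool" where
  "jordan_domain D \<longleftrightarrow>
     (\<exists>g. simple_path g \<and> pathfinish g = pathstart g \<and> D = inside (path_image g))"

definition holomorphic_matrix_on :: "(complex \<Rightarrow> complex^'n^'n) \<Rightarrow> complex set \<Rightarrow> bool" where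
  "holomorphic_matrix_on T S \<longleftrightarrow> (\<forall>i j. (\<lambda>z. T z $ i $ j) holomorphic_on S)"

definition eigenpair :: "(complex \<Rightarrow> complex^'n^'n) \<Rightarrow> complex \<Rightarrow> complex^'n \<Rightarrow> bool" where
  "eigenpair T \<mu> v \<longleftrightarrow> T \<mu> *v v = 0 \<and> v \<noteq> 0"

definition eigenvalues_in :: "(complex \<Rightarrow> complex^'n^'n) \<Rightarrow> complex set \<Rightarrow> complex set" where
  "eigenvalues_in T D = {\<mu> \<in> D. \<exists>v. eigenpair T \<mu> v}"

definition simple_eigenvalue :: "(complex \<Rightarrow> complex^'n^'n) \<Rightarrow> complex \<Rightarrow> bool" where
  "simple_eigenvalue T \<mu> \<longleftrightarrow> det (T \<mu>) = 0 \<and> zorder (\<lambda>z. det (T z)) \<mu> = 1"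

text \<open>Indexing. The \<open>n\<close> columns of \<open>U = [U\<^sub>D, U\<^sub>o\<^sub>u\<^sub>t]\<close> are indexed by the type \<open>'n\<close>. A subset
  \<open>M\<close> with \<open>m = card M\<close> plays the role of \<open>{1..m}\<close>: the column \<open>j\<close> of \<open>U\<close> is the eigenvector
  \<open>u j\<close> if \<open>j \<in> M\<close>, and the column \<open>w j\<close> of \<open>U\<^sub>o\<^sub>u\<^sub>t\<close> otherwise. Thus vectors of \<open>\<complex>\<^sup>m\<^sup>-\<^sup>1\<close> and
  \<open>\<complex>\<^sup>n\<^sup>-\<^sup>m\<close> are families over \<open>M - {i}\<close> and \<open>- M\<close>, with Euclidean norm given by \<^const>\<open>L2_set\<close>
  of the moduli. Values of \<open>u\<close> outside \<open>M\<close> and of \<open>w\<close> on \<open>M\<close> are irrelevant.\<close>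

definition U_mat :: "'n set \<Rightarrow> ('n \<Rightarrow> complex^'n) \<Rightarrow> ('n \<Rightarrow> complex^'n) \<Rightarrow> complex^'n^'n" where
  "U_mat M u w = (\<chi> r c. if c \<in> M then u c $ r else w c $ r)"

definition orthonormal_complement_basis ::
  "(complex^'n) set \<Rightarrow> 'n set \<Rightarrow> ('n \<Rightarrow> complex^'n) \<Rightarrow> bool" where
  "orthonormal_complement_basis S J w \<longleftrightarrow>
     (\<forall>j\<in>J. \<forall>k\<in>J. herm (w j) (w k) = (if j = k then 1 else 0))
     \<and> vec.span (w ` J) = {v. \<forall>s\<in>S. herm s v = 0}"

text \<open>The subspaces \<open>X\<close> to which the \<open>\<O>\<close>-statements apply.\<close>

definition admissible :: "(complex^'n) set \<Rightarrow> nat \<Rightarrow> real \<Rightarrow> (complex^'n) set \<Rightarrow> bool" where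
  "admissible UD m \<epsilon>T X \<longleftrightarrow>
     vec.subspace X \<and> vec.dim X = m \<and> max_principal_angle X UD \<le> \<epsilon>T"

text \<open>\<open>R X i\<close> and \<open>V X i\<close> are the \<open>i\<close>-th approximate eigenvalue and eigenvector extracted
  from \<open>X\<close>, in the order in which the procedure returns them.\<close>

definition extraction_procedure ::
  "complex set \<Rightarrow> 'n set \<Rightarrow> ((complex^'n) set \<Rightarrow> 'n \<Rightarrow> complex)
     \<Rightarrow> ((complex^'n) set \<Rightarrow> 'n \<Rightarrow> complex^'n) \<Rightarrow> bool" where
  "extraction_procedure D M R V \<longleftrightarrow>
     (\<forall>X. vec.subspace X \<and> vec.dim X = card M \<longrightarrow>
        (\<forall>i\<in>M. R X i \<in> D \<and> V X i \<in> X \<and> V X i \<noteq> 0))"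

text \<open>\<open>\<pi> X\<close> is the reordering of the pairs extracted from \<open>X\<close>; \<open>K\<close> is the constant hidden in
  the two \<open>\<O>(\<epsilon>)\<close>.\<close>

definition extraction_assumption ::
  "'n set \<Rightarrow> ('n \<Rightarrow> complex) \<Rightarrow> ('n \<Rightarrow> complex^'n) \<Rightarrow> real \<Rightarrow> real
     \<Rightarrow> ((complex^'n) set \<Rightarrow> 'n \<Rightarrow> complex) \<Rightarrow> ((complex^'n) set \<Rightarrow> 'n \<Rightarrow> complex^'n)
     \<Rightarrow> ((complex^'n) set \<Rightarrow> 'n \<Rightarrow> 'n) \<Rightarrow> bool" where
  "extraction_assumption M lam u K \<epsilon>T R V \<pi> \<longleftrightarrow>
     (let UD = vec.span (u ` M) in
      \<forall>X. admissible UD (card M) \<epsilon>T X \<longrightarrow>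
        bij_betw (\<pi> X) M M
        \<and> (\<forall>i\<in>M. cmod (R X (\<pi> X i) - lam i) \<le> K * max_principal_angle X UD
               \<and> vec_angle (V X (\<pi> X i)) (u i) \<le> K * max_principal_angle X UD))"

text \<open>\<open>(\<rho> i, x i)\<close> are the reordered pairs extracted from \<open>X\<close>, with the eigenvectors rescaled
  so that \<open>e\<^sub>i\<^sup>H U\<^sup>-\<^sup>1 x\<^sub>i = 1\<close>.\<close>

definition normalized_pairs ::
  "'n set \<Rightarrow> ('n \<Rightarrow> complex^'n) \<Rightarrow> ('n \<Rightarrow> complex^'n)
     \<Rightarrow> ((complex^'n) set \<Rightarrow> 'n \<Rightarrow> complex) \<Rightarrow> ((complex^'n) set \<Rightarrow> 'n \<Rightarrow> complex^'n)
     \<Rightarrow> ((complex^'n) set \<Rightarrow> 'n \<Rightarrow> 'n)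
     \<Rightarrow> (complex^'n) set \<Rightarrow> ('n \<Rightarrow> complex) \<Rightarrow> ('n \<Rightarrow> complex^'n) \<Rightarrow> bool" where
  "normalized_pairs M u w R V \<pi> X \<rho> x \<longleftrightarrow>
     (\<forall>i\<in>M. \<rho> i = R X (\<pi> X i)
        \<and> (\<exists>c. x i = c *s V X (\<pi> X i))
        \<and> (matrix_inv (U_mat M u w) *v x i) $ i = 1)"

definition filter_bounds ::
  "'n set \<Rightarrow> ('n \<Rightarrow> complex^'n) \<Rightarrow> ('n \<Rightarrow> complex^'n) \<Rightarrow> real \<Rightarrow> real
     \<Rightarrow> ((complex^'n) set \<Rightarrow> 'n \<Rightarrow> complex) \<Rightarrow> ((complex^'n) set \<Rightarrow> 'n \<Rightarrow> complex^'n)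
     \<Rightarrow> ((complex^'n) set \<Rightarrow> 'n \<Rightarrow> 'n)
     \<Rightarrow> (nat \<Rightarrow> complex \<Rightarrow> complex^'n^'n) \<Rightarrow> (nat \<Rightarrow> real) \<Rightarrow> bool" where
  "filter_bounds M u w K \<epsilon>T R V \<pi> F \<gamma> \<longleftrightarrow>
     (let UD = vec.span (u ` M) in
      \<forall>N\<ge>1. \<forall>X \<rho> x. admissible UD (card M) \<epsilon>T X \<longrightarrow> normalized_pairs M u w R V \<pi> X \<rho> x \<longrightarrow>
        (\<forall>i\<in>M. \<exists>\<alpha> y z.
            F N (\<rho> i) *v x i
              = \<alpha> *s u i + (\<Sum>j\<in>M - {i}. y j *s u j) + (\<Sum>j\<in>- M. z j *s w j)
          \<and> cmod (\<alpha> - 1) \<le> K * (\<gamma> N + max_principal_angle X UD)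
          \<and> L2_set (\<lambda>j. cmod (y j)) (M - {i}) \<le> K * (\<gamma> N + max_principal_angle X UD)
          \<and> L2_set (\<lambda>j. cmod (z j)) (- M) \<le> K * (\<gamma> N * max_principal_angle X UD)))"

end

theory Submission
  imports Defs
begin

text \<open>
  The new vectors are \<open>f\<^sub>i = \<Sum>\<^sub>j A\<^sub>i\<^sub>j u\<^sub>j + r\<^sub>i\<close>, where \<open>A\<close> differs from the identity by entries of
  size \<open>O(\<gamma>\<^sub>N + \<epsilon>)\<close> and the remainder \<open>r\<^sub>i\<close> is orthogonal to the span of the eigenvectors and
  has norm \<open>O(\<gamma>\<^sub>N \<epsilon>)\<close>. Once \<open>\<gamma>\<^sub>N + \<epsilon>\<close> is below a constant, \<open>A\<close> is strictly diagonally dominant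
  (\<open>near_identity_coefficients\<close>), so a unit vector \<open>\<Sum>\<^sub>i c\<^sub>i f\<^sub>i\<close> has coefficients bounded by a
  constant that depends only on the eigenvectors (\<open>coefficients_bounded_by_norm\<close>). Hence its
  component orthogonal to the eigenvectors is \<open>\<Sum>\<^sub>i c\<^sub>i r\<^sub>i\<close>, of norm \<open>O(\<gamma>\<^sub>N \<epsilon>)\<close>: every unit vector
  of the new subspace is that close to the eigenvector span (\<open>perturbed_basis_angle\<close>).

  It remains to pass from this distance to the largest principal angle. The angle is given by
  successive maximization, and the bridge is \<open>max_principal_angle_le_dist\<close>: if \<open>x\<^sub>k, y\<^sub>k\<close> is the
  last pair of principal vectors of \<open>X\<close> and \<open>Y\<close>, then the maximality of the earlier pairs makes
  \<open>x\<^sub>k\<close> orthogonal to the earlier \<open>y\<^sub>j\<close> (\<open>principal_vectors_cross_zero\<close>). The orthogonal projection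
  \<open>p\<close> of \<open>x\<^sub>k\<close> to \<open>Y\<close> inherits this, so after normalization it competes with \<open>y\<^sub>k\<close> in the last
  maximization and the cosine is at least \<open>\<parallel>p\<parallel>\<close>. The sine is therefore at most the distance from
  \<open>x\<^sub>k\<close> to \<open>Y\<close>, and Jordan's inequality turns the sine into the angle.
\<close>

section \<open>The Hermitian inner product\<close>

lemma herm_add_left: "herm (a + b) c = herm a c + herm b c"
  by (simp add: herm_def algebra_simps sum.distrib)

lemma herm_add_right: "herm a (b + c) = herm a b + herm a c"
  by (simp add: herm_def algebra_simps sum.distrib)

lemma herm_diff_right: "herm a (b - c) = herm a b - herm a c"
  by (simp add: herm_def algebra_simps sum_subtractf)

lemma herm_scale_left: "herm (c *s a) b = cnj c * herm a b"
  by (simp add: herm_def sum_distrib_left algebra_simps)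

lemma herm_scale_right: "herm a (c *s b) = c * herm a b"
  by (simp add: herm_def sum_distrib_left algebra_simps)

lemma herm_zero [simp]: "herm a 0 = 0" "herm 0 a = 0"
  by (simp_all add: herm_def)

lemma herm_sum_right: "herm a (\<Sum>i\<in>I. f i) = (\<Sum>i\<in>I. herm a (f i))"
  by (induction I rule: infinite_finite_induct) (simp_all add: herm_add_right)

lemma cnj_herm: "cnj (herm a b) = herm b a"
  by (simp add: herm_def mult.commute)

lemma herm_eq_0_commute: "herm a b = 0 \<longleftrightarrow> herm b a = 0"
  by (metis cnj_herm complex_cnj_zero_iff)

lemma Re_herm: "Re (herm a b) = a \<bullet> b"
  by (simp add: herm_def inner_vec_def inner_complex_def)

lemma herm_self: "herm v v = of_real ((norm v)\<^sup>2)"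
  by (rule complex_eqI)
    (simp_all add: Re_herm power2_norm_eq_inner, simp add: herm_def)

lemma norm_scale: "norm (c *s v) = cmod c * norm (v :: complex^'n)"
  by (simp add: norm_vec_def norm_mult L2_set_right_distrib)

lemma scaleR_eq_scale: "c *\<^sub>R v = complex_of_real c *s v"
  unfolding vec_eq_iff by (simp add: scaleR_conv_of_real[where 'a = complex])

lemma norm_normalize:
  "v \<noteq> 0 \<Longrightarrow> norm (complex_of_real (1 / norm v) *s v) = 1"
  by (simp add: norm_scale norm_divide)

text \<open>The real inner product is the real part of the Hermitian one, so the real inequality
  suffices after \<open>w\<close> is rotated by a phase that makes the product real and nonnegative.\<close>

lemma herm_Cauchy_Schwarz: "cmod (herm v w) \<le> norm v * norm w"
proof -
  obtain c where c: "cmod c = 1" "c * herm v w = of_real (cmod (herm v w))"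
  proof (cases "herm v w = 0")
    case True
    then show ?thesis using that[of 1] by simp
  next
    case False
    then show ?thesis
      using that[of "cnj (herm v w) / of_real (cmod (herm v w))"]
      by (simp add: norm_divide complex_norm_square[symmetric] power2_eq_square mult.commute)
  qed
  then have "cmod (herm v w) = v \<bullet> (c *s w)"
    by (metis Re_complex_of_real Re_herm herm_scale_right)
  also have "\<dots> \<le> norm v * norm (c *s w)"
    by (rule norm_cauchy_schwarz)
  finally show ?thesis by (simp add: norm_scale c)
qed

lemma norm_add_orthogonal:
  assumes "herm p r = 0"
  shows "(norm (p + r))\<^sup>2 = (norm p)\<^sup>2 + (norm r)\<^sup>2"
proof -
  have "p \<bullet> r = 0" using assms by (metis Re_herm zero_complex.simps(1))
  then show ?thesis by (simp add: power2_norm_eq_inner inner_add inner_commute)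
qed

lemma norm_orthonormal_sum:
  assumes "finite J" and "\<And>j k. j \<in> J \<Longrightarrow> k \<in> J \<Longrightarrow> herm (w j) (w k) = (if j = k then 1 else 0)"
  shows "norm (\<Sum>j\<in>J. z j *s w j) = L2_set (\<lambda>j. cmod (z j)) J"
proof -
  have "(norm (\<Sum>j\<in>J. z j *s w j))\<^sup>2 = (\<Sum>j\<in>J. (cmod (z j))\<^sup>2)"
    using assms
  proof (induction J)
    case (insert a J)
    have "herm (z a *s w a) (\<Sum>j\<in>J. z j *s w j) = 0"
      unfolding herm_sum_right herm_scale_left herm_scale_right
      using insert by (intro sum.neutral) auto
    moreover have "norm (w a) = 1"
    proof (rule power2_eq_imp_eq)
      have "complex_of_real ((norm (w a))\<^sup>2) = complex_of_real (1\<^sup>2)"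
        using insert.prems[of a a] unfolding herm_self by simp
      then show "(norm (w a))\<^sup>2 = 1\<^sup>2" by (simp only: of_real_eq_iff)
    qed simp_all
    ultimately show ?case
      using insert by (simp add: norm_add_orthogonal norm_scale)
  qed simp
  then show ?thesis by (simp add: L2_set_def real_sqrt_unique)
qed

section \<open>Principal vectors\<close>

text \<open>Subtracting from a vector outside the span of the \<open>x j\<close> its projection to that span
  leaves a nonzero residual. This lets the recursive choice of principal vectors continue
  until the smaller of the two dimensions is reached.\<close>

lemma unit_vector_orthogonal_to_fewer:
  fixes X :: "(complex^'n) set"
  assumes X: "vec.subspace X" and k: "k < vec.dim X"
    and x: "\<And>j. j < k \<Longrightarrow> x j \<in> X \<and> norm (x j) = 1"
    and orth: "\<And>i j. i < j \<Longrightarrow> j < k \<Longrightarrow> herm (x i) (x j) = 0"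
  obtains v where "v \<in> X" "norm v = 1" "\<And>j. j < k \<Longrightarrow> herm (x j) v = 0"
proof -
  have "vec.dim (vec.span (x ` {..<k})) \<le> card (x ` {..<k})"
    by (rule vec.dim_le_card) simp_all
  also have "\<dots> \<le> k" using card_image_le[of "{..<k}" x] by simp
  finally have "\<not> X \<subseteq> vec.span (x ` {..<k})"
    using k vec.dim_subset[of X "vec.span (x ` {..<k})"] by linarith
  then obtain v where v: "v \<in> X" "v \<notin> vec.span (x ` {..<k})" by blast
  define s where "s = v - (\<Sum>i<k. herm (x i) v *s x i)"
  have sum_span: "(\<Sum>i<k. herm (x i) v *s x i) \<in> vec.span (x ` {..<k})"
    by (intro vec.span_sum vec.span_scale vec.span_base) auto
  have "s \<noteq> 0" using v(2) sum_span unfolding s_def by force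
  have "s \<in> X"
    unfolding s_def using X v x by (intro vec.subspace_diff vec.subspace_sum vec.subspace_scale) auto
  have s_orth: "herm (x j) s = 0" if j: "j < k" for j
  proof -
    have xx: "herm (x j) (x i) = (if i = j then 1 else 0)" if "i < k" for i
    proof (cases i j rule: linorder_cases)
      case less
      then show ?thesis using orth[OF less j] by (simp add: herm_eq_0_commute[of "x j"])
    next
      case equal
      then show ?thesis using x[OF j] by (simp add: herm_self)
    next
      case greater
      then show ?thesis using orth[OF greater that] by simp
    qed
    have "(\<Sum>i<k. herm (x i) v * herm (x j) (x i)) = herm (x j) v"
    proof -
      have "(\<Sum>i<k. herm (x i) v * herm (x j) (x i)) = (\<Sum>i<k. if i = j then herm (x i) v else 0)"
        by (rule sum.cong) (auto simp: xx)
      then show ?thesis using j by simp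
    qed
    then show ?thesis
      by (simp add: s_def herm_diff_right herm_sum_right herm_scale_right)
  qed
  show ?thesis
  proof (rule that)
    show "complex_of_real (1 / norm s) *s s \<in> X" using X \<open>s \<in> X\<close> by (rule vec.subspace_scale)
    show "norm (complex_of_real (1 / norm s) *s s) = 1" using \<open>s \<noteq> 0\<close> by (rule norm_normalize)
  qed (simp add: herm_scale_right s_orth)
qed

lemma closed_vec_subspace:
  fixes X :: "(complex^'n) set"
  assumes "vec.subspace X"
  shows "closed X"
proof (rule closed_subspace)
  show "subspace X"
    using assms by (simp add: subspace_def vec.subspace_def scaleR_eq_scale)
qed

lemma continuous_on_herm:
  assumes "continuous_on S f" "continuous_on S g"
  shows "continuous_on S (\<lambda>t. herm (f t) (g t))"
  unfolding herm_def by (intro continuous_intros assms)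

lemma principal_vectorsD:
  assumes "principal_vectors X Y q x y" and "k < q"
  shows "x k \<in> X" "norm (x k) = 1" "y k \<in> Y" "norm (y k) = 1"
    and "\<And>j. j < k \<Longrightarrow> herm (x j) (x k) = 0" "\<And>j. j < k \<Longrightarrow> herm (y j) (y k) = 0"
    and "\<And>v w. v \<in> X \<Longrightarrow> w \<in> Y \<Longrightarrow> norm v = 1 \<Longrightarrow> norm w = 1
      \<Longrightarrow> \<forall>j<k. herm (x j) v = 0 \<and> herm (y j) w = 0 \<Longrightarrow> cmod (herm v w) \<le> cmod (herm (x k) (y k))"
proof -
  note pv = assms(1)[unfolded principal_vectors_def, THEN spec, THEN mp, OF assms(2)]
  show "x k \<in> X" "norm (x k) = 1" "y k \<in> Y" "norm (y k) = 1"
    and "\<And>j. j < k \<Longrightarrow> herm (x j) (x k) = 0" "\<And>j. j < k \<Longrightarrow> herm (y j) (y k) = 0"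
    using pv by simp_all
  show "\<And>v w. v \<in> X \<Longrightarrow> w \<in> Y \<Longrightarrow> norm v = 1 \<Longrightarrow> norm w = 1
      \<Longrightarrow> \<forall>j<k. herm (x j) v = 0 \<and> herm (y j) w = 0 \<Longrightarrow> cmod (herm v w) \<le> cmod (herm (x k) (y k))"
    using pv by (elim conjE) (drule (1) bspec, drule (1) bspec, drule (1) mp, drule (1) mp, erule (1) mp)
qed

text \<open>Each maximum is attained because the admissible pairs form a nonempty compact set. The
  angle is defined by a choice operator, so nothing can be said about it without this.\<close>

lemma principal_vectors_exist:
  fixes X Y :: "(complex^'n) set"
  assumes X: "vec.subspace X" and Y: "vec.subspace Y"
  shows "q \<le> min (vec.dim X) (vec.dim Y) \<Longrightarrow> \<exists>x y. principal_vectors X Y q x y"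
proof (induction q)
  case 0
  then show ?case by (simp add: principal_vectors_def)
next
  case (Suc q)
  then obtain x y where xy: "principal_vectors X Y q x y" by auto
  define A where "A Z z = (Z \<inter> sphere 0 1) \<inter> (\<Inter>j<q. {v. herm (z j) v = 0})"
    for Z :: "(complex^'n) set" and z
  have compact_A: "compact (A Z z)" if "vec.subspace Z" for Z z
    unfolding A_def using that closed_vec_subspace
    by (intro compact_Int_closed closed_Int_compact closed_INT ballI closed_Collect_eq
          continuous_on_herm continuous_intros) auto
  have "A Z z \<noteq> {}"
    if Z: "vec.subspace Z" "q < vec.dim Z" "\<And>j. j < q \<Longrightarrow> z j \<in> Z \<and> norm (z j) = 1"
      "\<And>i j. i < j \<Longrightarrow> j < q \<Longrightarrow> herm (z i) (z j) = 0" for Z z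
  proof -
    obtain v where "v \<in> Z" "norm v = 1" "\<And>j. j < q \<Longrightarrow> herm (z j) v = 0"
      using unit_vector_orthogonal_to_fewer[where x = z, OF Z] by blast
    then have "v \<in> A Z z" by (simp add: A_def)
    then show ?thesis by blast
  qed
  from this[OF X, of x] this[OF Y, of y] have "A X x \<times> A Y y \<noteq> {}"
    using principal_vectorsD[OF xy] Suc.prems by simp
  moreover have "continuous_on (A X x \<times> A Y y) (\<lambda>p. cmod (herm (fst p) (snd p)))"
    by (intro continuous_intros continuous_on_herm)
  ultimately have "\<exists>p\<in>A X x \<times> A Y y. \<forall>p'\<in>A X x \<times> A Y y.
      cmod (herm (fst p') (snd p')) \<le> cmod (herm (fst p) (snd p))"
    by (intro continuous_attains_sup compact_Times compact_A X Y)
  then obtain p where p: "p \<in> A X x \<times> A Y y"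
    "\<And>p'. p' \<in> A X x \<times> A Y y \<Longrightarrow> cmod (herm (fst p') (snd p')) \<le> cmod (herm (fst p) (snd p))"
    by blast
  obtain a b where ab: "p = (a, b)" by (cases p)
  have a: "a \<in> A X x" and b: "b \<in> A Y y" using p(1) ab by auto
  have max: "cmod (herm v w) \<le> cmod (herm a b)" if "v \<in> A X x" "w \<in> A Y y" for v w
    using p(2)[of "(v, w)"] that ab by simp
  have "principal_vectors X Y (Suc q) (x(q := a)) (y(q := b))"
    unfolding principal_vectors_def
  proof (intro allI impI)
    fix k assume "k < Suc q"
    then consider "k < q" | "k = q" by linarith
    then show "(x(q := a)) k \<in> X \<and> (y(q := b)) k \<in> Y \<and> norm ((x(q := a)) k) = 1
        \<and> norm ((y(q := b)) k) = 1
        \<and> (\<forall>j<k. herm ((x(q := a)) j) ((x(q := a)) k) = 0 \<and> herm ((y(q := b)) j) ((y(q := b)) k) = 0)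
        \<and> (\<forall>v\<in>X. \<forall>w\<in>Y. norm v = 1 \<longrightarrow> norm w = 1
              \<longrightarrow> (\<forall>j<k. herm ((x(q := a)) j) v = 0 \<and> herm ((y(q := b)) j) w = 0)
              \<longrightarrow> cmod (herm v w) \<le> cmod (herm ((x(q := a)) k) ((y(q := b)) k)))"
    proof cases
      case 1
      then show ?thesis using xy unfolding principal_vectors_def by auto
    next
      case 2
      then show ?thesis using a b max unfolding A_def by auto
    qed
  qed
  then show ?case by (intro exI)
qed

lemma max_principal_angle_cases:
  fixes X Y :: "(complex^'n) set"
  assumes X: "vec.subspace X" and Y: "vec.subspace Y"
  obtains (trivial) "max_principal_angle X Y = 0"
  | (principal) k x y where "principal_vectors X Y (Suc k) x y"
      "max_principal_angle X Y = arccos (cmod (herm (x k) (y k)))"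
proof (cases "min (vec.dim X) (vec.dim Y)")
  case 0
  then show ?thesis using trivial by (simp add: max_principal_angle_def)
next
  case (Suc k)
  obtain x y where "principal_vectors X Y (Suc k) x y"
    using principal_vectors_exist[OF X Y, of "Suc k"] Suc by auto
  then have "\<exists>\<theta> x y. principal_vectors X Y (Suc k) x y \<and> \<theta> = arccos (cmod (herm (x k) (y k)))"
    by blast
  note someI_ex[OF this]
  moreover have "max_principal_angle X Y
      = (SOME \<theta>. \<exists>x y. principal_vectors X Y (Suc k) x y \<and> \<theta> = arccos (cmod (herm (x k) (y k))))"
    unfolding max_principal_angle_def Suc Let_def diff_Suc_1 by (simp only: nat.distinct if_False)
  ultimately obtain x y where "principal_vectors X Y (Suc k) x y"
    and "max_principal_angle X Y = arccos (cmod (herm (x k) (y k)))"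
    by metis
  then show ?thesis by (rule principal)
qed

lemma max_principal_angle_nonneg:
  fixes X Y :: "(complex^'n) set"
  assumes "vec.subspace X" and "vec.subspace Y"
  shows "0 \<le> max_principal_angle X Y"
  using assms
proof (cases rule: max_principal_angle_cases)
  case (principal k x y)
  have "cmod (herm (x k) (y k)) \<le> 1"
    using herm_Cauchy_Schwarz[of "x k" "y k"] principal_vectorsD(2,4)[OF principal(1), of k] by simp
  moreover have "-1 \<le> cmod (herm (x k) (y k))"
    using norm_ge_zero[of "herm (x k) (y k)"] by linarith
  ultimately show ?thesis unfolding principal(2) by (rule arccos_lbound[rotated])
qed simp

text \<open>If \<open>x\<^sub>k\<close> had a component along an earlier \<open>y\<^sub>j\<close>, then tilting \<open>x\<^sub>j\<close> towards \<open>x\<^sub>k\<close> would increase the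
  \<open>j\<close>-th maximum: with \<open>s = x\<^sub>j\<^sup>H y\<^sub>j\<close> and \<open>t = x\<^sub>k\<^sup>H y\<^sub>j\<close> the best unit combination of \<open>x\<^sub>j\<close> and
  \<open>x\<^sub>k\<close> attains \<open>sqrt (\<bar>s\<bar>\<^sup>2 + \<bar>t\<bar>\<^sup>2)\<close> against \<open>y\<^sub>j\<close>.\<close>

lemma principal_vectors_cross_zero:
  fixes X Y :: "(complex^'n) set"
  assumes X: "vec.subspace X" and xy: "principal_vectors X Y q x y" and "j < k" "k < q"
  shows "herm (y j) (x k) = 0"
proof -
  have "j < q" using assms(3,4) by simp
  note j = principal_vectorsD[OF xy \<open>j < q\<close>] and k = principal_vectorsD[OF xy \<open>k < q\<close>]
  define s t r where "s = herm (x j) (y j)" and "t = herm (x k) (y j)"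
    and "r = sqrt ((cmod s)\<^sup>2 + (cmod t)\<^sup>2)"
  define v where "v = s *s x j + t *s x k"
  have "(norm v)\<^sup>2 = r\<^sup>2"
    unfolding v_def r_def
    by (subst norm_add_orthogonal)
      (simp_all add: herm_scale_left herm_scale_right norm_scale j(2) k(2) k(5)[OF \<open>j < k\<close>])
  then have nv: "norm v = r" by (rule power2_eq_imp_eq) (simp_all add: r_def)
  have hv: "herm v (y j) = of_real (r\<^sup>2)"
    by (simp add: v_def r_def herm_add_left herm_scale_left s_def[symmetric] t_def[symmetric]
        complex_norm_square[symmetric] mult.commute)
  have "r \<le> cmod s"
  proof (cases "r = 0")
    case False
    then have "r > 0" by (simp add: r_def less_le)
    have "cmod (herm (complex_of_real (1 / norm v) *s v) (y j)) \<le> cmod (herm (x j) (y j))"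
    proof (rule j(7))
      show "complex_of_real (1 / norm v) *s v \<in> X"
        unfolding v_def by (intro vec.subspace_scale vec.subspace_add X j(1) k(1))
      show "norm (complex_of_real (1 / norm v) *s v) = 1" using \<open>r > 0\<close> nv by (intro norm_normalize) auto
      show "\<forall>i<j. herm (x i) (complex_of_real (1 / norm v) *s v) = 0 \<and> herm (y i) (y j) = 0"
        using j(5,6) k(5) \<open>j < k\<close> by (simp add: v_def herm_scale_right herm_add_right)
    qed (fact j(3,4))+
    then show ?thesis
      using \<open>r > 0\<close> nv by (simp add: herm_scale_left hv norm_mult norm_divide norm_power s_def power2_eq_square)
  qed simp
  then have "r\<^sup>2 \<le> (cmod s)\<^sup>2" by (rule power_mono) (simp add: r_def)
  then have "t = 0" by (simp add: r_def)
  then show ?thesis by (simp add: t_def herm_eq_0_commute)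
qed

section \<open>Bounding the largest principal angle by a distance\<close>

text \<open>The sine is concave on \<open>[0, \<pi>]\<close>, so it lies above its chord from \<open>0\<close> to \<open>\<pi>/2\<close>.\<close>

lemma Jordan_sin_inequality:
  assumes "0 \<le> x" "x \<le> pi / 2"
  shows "2 / pi * x \<le> sin x"
proof -
  have "concave_on {0..pi} sin"
  proof (rule f''_le0_imp_concave)
    show "(sin has_real_derivative cos x) (at x)" "(cos has_real_derivative - sin x) (at x)" for x :: real
      by (auto intro!: derivative_eq_intros)
  qed (auto intro!: sin_ge_zero)
  from concave_onD[OF this, of "2 / pi * x" 0 "pi / 2"] assms show ?thesis
    by (simp add: field_simps)
qed

lemma arccos_le_of_dist:
  assumes "0 \<le> c" and "0 \<le> d" and "1 \<le> c\<^sup>2 + d\<^sup>2" and "c \<le> 1"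
  shows "arccos c \<le> pi / 2 * d"
proof -
  have t: "0 \<le> arccos c" "arccos c \<le> pi / 2"
    using assms by (intro arccos_lbound arccos_le_pi2; simp)+
  have "sin (arccos c) = sqrt (1 - c\<^sup>2)" using assms by (intro sin_arccos) auto
  also have "\<dots> \<le> d" using assms by (intro real_le_lsqrt) auto
  finally have "2 / pi * arccos c \<le> d" using Jordan_sin_inequality[OF t] by linarith
  then show ?thesis by (simp add: field_simps)
qed

text \<open>The decomposition \<open>v = p + r\<close> is the orthogonal one, so \<open>\<delta>\<close> bounds the distance from unit
  vectors of \<open>X\<close> to \<open>Y\<close>. Applied to the last principal vector \<open>x\<^sub>k\<close>, it makes the normalized
  \<open>p\<close> a candidate for \<open>y\<^sub>k\<close>; as \<open>\<bar>x\<^sub>k\<^sup>H p\<bar> = \<parallel>p\<parallel>\<^sup>2\<close>, the cosine of the angle is at least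
  \<open>\<parallel>p\<parallel> = sqrt (1 - \<parallel>r\<parallel>\<^sup>2)\<close>.\<close>

lemma max_principal_angle_le_dist:
  fixes X Y :: "(complex^'n) set"
  assumes X: "vec.subspace X" and Y: "vec.subspace Y" and "0 \<le> \<delta>"
    and split: "\<And>v. v \<in> X \<Longrightarrow> norm v = 1 \<Longrightarrow>
      \<exists>p r. v = p + r \<and> p \<in> Y \<and> (\<forall>s\<in>Y. herm s r = 0) \<and> norm r \<le> \<delta>"
  shows "max_principal_angle X Y \<le> pi / 2 * \<delta>"
  using X Y
proof (cases rule: max_principal_angle_cases)
  case trivial
  then show ?thesis using \<open>0 \<le> \<delta>\<close> by simp
next
  case (principal k x y)
  note pv = principal(1)
  note k = principal_vectorsD[OF pv lessI]
  have y: "y i \<in> Y" if "i < k" for i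
    using principal_vectorsD(3)[OF pv] that by simp
  obtain p r where pr: "x k = p + r" "p \<in> Y" "\<And>s. s \<in> Y \<Longrightarrow> herm s r = 0" "norm r \<le> \<delta>"
    using split[OF k(1,2)] by blast
  have yp: "herm (y i) p = 0" if "i < k" for i
    using principal_vectors_cross_zero[OF X pv that lessI] pr(1) pr(3)[OF y[OF that]]
    by (simp add: herm_add_right)
  have xp: "herm (x k) p = of_real ((norm p)\<^sup>2)"
    using pr(1) pr(3)[OF pr(2)] by (simp add: herm_add_left herm_self herm_eq_0_commute[of r p])
  let ?c = "cmod (herm (x k) (y k))"
  have "norm p \<le> ?c"
  proof (cases "p = 0")
    case False
    have "cmod (herm (x k) (complex_of_real (1 / norm p) *s p)) \<le> ?c"
    proof (rule k(7))
      show "complex_of_real (1 / norm p) *s p \<in> Y" using Y pr(2) by (rule vec.subspace_scale)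
      show "norm (complex_of_real (1 / norm p) *s p) = 1" using False by (rule norm_normalize)
    qed (simp_all add: k(1,2,5) yp herm_scale_right)
    then show ?thesis
      using False by (simp add: herm_scale_right xp norm_mult norm_divide norm_power power2_eq_square)
  qed simp
  then have "(norm p)\<^sup>2 + (norm r)\<^sup>2 \<le> ?c\<^sup>2 + \<delta>\<^sup>2"
    using pr(4) by (intro add_mono power_mono) auto
  moreover have "(norm p)\<^sup>2 + (norm r)\<^sup>2 = 1"
    using norm_add_orthogonal[of p r] pr(1) pr(3)[OF pr(2)] k(2) by simp
  moreover have "?c \<le> 1" using herm_Cauchy_Schwarz[of "x k" "y k"] k(2,4) by simp
  ultimately show ?thesis
    unfolding principal(2) using \<open>0 \<le> \<delta>\<close> by (intro arccos_le_of_dist) simp_all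
qed

section \<open>Perturbation of a basis\<close>

lemma span_image_finite_sum:
  fixes f :: "'i \<Rightarrow> complex^'n"
  assumes "finite I" and "v \<in> vec.span (f ` I)"
  obtains c where "v = (\<Sum>i\<in>I. c i *s f i)"
proof -
  let ?S = "range (\<lambda>c. \<Sum>i\<in>I. c i *s f i)"
  have "vec.subspace ?S"
    unfolding vec.subspace_def
  proof (intro conjI ballI allI)
    show "0 \<in> ?S" by (rule range_eqI[of _ _ "\<lambda>_. 0"]) simp
    show "a + b \<in> ?S" if "a \<in> ?S" "b \<in> ?S" for a b
    proof -
      from that obtain c d where "a = (\<Sum>i\<in>I. c i *s f i)" "b = (\<Sum>i\<in>I. d i *s f i)" by auto
      then show ?thesis
        by (intro range_eqI[of _ _ "\<lambda>i. c i + d i"])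
          (simp add: vec.scale_left_distrib sum.distrib)
    qed
    show "e *s a \<in> ?S" if "a \<in> ?S" for e a
    proof -
      from that obtain c where "a = (\<Sum>i\<in>I. c i *s f i)" by auto
      then show ?thesis
        by (intro range_eqI[of _ _ "\<lambda>i. e * c i"]) (simp add: vec.scale_sum_right)
    qed
  qed
  moreover have "f ` I \<subseteq> ?S"
  proof safe
    fix i assume "i \<in> I"
    have "(\<Sum>k\<in>I. (if k = i then 1 else 0) *s f k) = (\<Sum>k\<in>I. if k = i then f k else 0)"
      by (rule sum.cong) auto
    then show "f i \<in> ?S"
      using \<open>i \<in> I\<close> assms(1) by (intro range_eqI[of _ _ "\<lambda>k. if k = i then 1 else 0"]) simp
  qed
  ultimately have "vec.span (f ` I) \<subseteq> ?S" by (rule vec.span_minimal[rotated])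
  then show ?thesis using that assms(2) by blast
qed

text \<open>Independent vectors admit a linear left inverse sending \<open>u j\<close> to the \<open>j\<close>-th unit vector,
  and \<open>L\<close> comes from its operator norm. It measures how ill-conditioned the family \<open>u\<close> is.\<close>

lemma coefficients_bounded_by_norm:
  fixes u :: "'n \<Rightarrow> complex^'n"
  assumes "inj_on u M" and "vec.independent (u ` M)"
  obtains L where "0 < L" "\<And>a. (\<Sum>j\<in>M. cmod (a j)) \<le> L * norm (\<Sum>j\<in>M. a j *s u j)"
proof -
  obtain g :: "complex^'n \<Rightarrow> complex^'n" where g: "Vector_Spaces.linear (*s) (*s) g"
    and gu: "\<And>v. v \<in> u ` M \<Longrightarrow> g v = axis (the_inv_into M u v) 1"
    using vec.linear_independent_extend[OF assms(2), of "\<lambda>v. axis (the_inv_into M u v) 1"] by blast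
  have gu': "g (u j) = axis j 1" if "j \<in> M" for j
    using gu that by (simp add: the_inv_into_f_f[OF assms(1)])
  interpret g: Vector_Spaces.linear "(*s)" "(*s)" g by (rule g)
  have "linear g" by (intro linearI) (simp_all add: g.add g.scale scaleR_eq_scale)
  then obtain B where B: "B > 0" "\<And>v. norm (g v) \<le> B * norm v"
    using linear_bounded_pos by blast
  have bound: "(\<Sum>j\<in>M. cmod (a j)) \<le> (real (card M) * B + 1) * norm (\<Sum>j\<in>M. a j *s u j)"
    (is "_ \<le> _ * norm ?v") for a
  proof -
    have "cmod (a j) \<le> B * norm ?v" if "j \<in> M" for j
    proof -
      have "g ?v = (\<Sum>i\<in>M. a i *s axis i 1)"
        by (simp add: g.sum g.scale gu')
      then have "g ?v $ j = (\<Sum>i\<in>M. if i = j then a i else 0)"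
        by (simp add: axis_def if_distrib eq_commute cong: if_cong)
      then have "g ?v $ j = a j"
        using that by simp
      then show ?thesis
        using B(2)[of ?v] Finite_Cartesian_Product.norm_nth_le[of "g ?v" j] by simp
    qed
    then have "(\<Sum>j\<in>M. cmod (a j)) \<le> real (card M) * (B * norm ?v)"
      using sum_bounded_above[of M "\<lambda>j. cmod (a j)"] by simp
    then show ?thesis by (simp add: algebra_simps add_increasing)
  qed
  show ?thesis by (rule that[OF _ bound]) (use B(1) in \<open>simp add: add_nonneg_pos\<close>)
qed

text \<open>Each \<open>c j\<close> differs from the \<open>j\<close>-th entry of the product by at most \<open>\<eta> \<Sum>\<^sub>i \<bar>c i\<bar>\<close>. Summed over
  \<open>j\<close> the errors amount to at most half of \<open>\<Sum>\<^sub>i \<bar>c i\<bar>\<close> and can be absorbed.\<close>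

lemma near_identity_coefficients:
  fixes A :: "'i \<Rightarrow> 'i \<Rightarrow> complex"
  assumes "finite M" and \<eta>: "real (card M) * \<eta> \<le> 1 / 2"
    and A: "\<And>i j. i \<in> M \<Longrightarrow> j \<in> M \<Longrightarrow> cmod (A i j - (if i = j then 1 else 0)) \<le> \<eta>"
  shows "(\<Sum>i\<in>M. cmod (c i)) \<le> 2 * (\<Sum>j\<in>M. cmod (\<Sum>i\<in>M. c i * A i j))"
proof -
  let ?S = "\<Sum>i\<in>M. cmod (c i)"
  let ?a = "\<lambda>j. \<Sum>i\<in>M. c i * A i j"
  have "cmod (c j) \<le> cmod (?a j) + \<eta> * ?S" if "j \<in> M" for j
  proof -
    let ?e = "\<Sum>i\<in>M. c i * (A i j - (if i = j then 1 else 0))"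
    have "?e = ?a j - (\<Sum>i\<in>M. if i = j then c i else 0)"
      unfolding sum_subtractf[symmetric] by (intro sum.cong) (auto simp: algebra_simps)
    also have "\<dots> = ?a j - c j" using that assms(1) by simp
    finally have "c j = ?a j - ?e" by simp
    then have "cmod (c j) \<le> cmod (?a j) + cmod ?e" by (metis norm_triangle_ineq4)
    moreover have "cmod ?e \<le> (\<Sum>i\<in>M. cmod (c i) * \<eta>)"
      by (intro sum_norm_le) (simp add: norm_mult mult_left_mono A that)
    ultimately show ?thesis by (simp add: sum_distrib_left mult.commute)
  qed
  then have "?S \<le> (\<Sum>j\<in>M. cmod (?a j) + \<eta> * ?S)" by (rule sum_mono)
  also have "\<dots> = (\<Sum>j\<in>M. cmod (?a j)) + real (card M) * \<eta> * ?S"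
    by (simp add: sum.distrib)
  also have "\<dots> \<le> (\<Sum>j\<in>M. cmod (?a j)) + 1 / 2 * ?S"
    using \<eta> by (intro add_left_mono mult_right_mono) (auto intro: sum_nonneg)
  finally show ?thesis by simp
qed

text \<open>The perturbation \<open>A\<close> within the span of the \<open>u j\<close> only has to be small, since it does not
  move the spanned subspace; the angle is controlled by the remainders \<open>r\<close> alone. This is why
  bounds \<open>O(\<gamma>\<^sub>N + \<epsilon>)\<close> on the former and \<open>O(\<gamma>\<^sub>N \<epsilon>)\<close> on the latter give an angle \<open>O(\<gamma>\<^sub>N \<epsilon>)\<close>.\<close>

lemma perturbed_basis_angle:
  fixes u f :: "'n \<Rightarrow> complex^'n"
  assumes L: "0 < L" "\<And>a. (\<Sum>j\<in>M. cmod (a j)) \<le> L * norm (\<Sum>j\<in>M. a j *s u j)"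
    and \<eta>: "real (card M) * \<eta> \<le> 1 / 2" and \<tau>: "0 \<le> \<tau>"
    and A: "\<And>i j. i \<in> M \<Longrightarrow> j \<in> M \<Longrightarrow> cmod (A i j - (if i = j then 1 else 0)) \<le> \<eta>"
    and f: "\<And>i. i \<in> M \<Longrightarrow> f i = (\<Sum>j\<in>M. A i j *s u j) + r i"
    and r: "\<And>i s. i \<in> M \<Longrightarrow> s \<in> vec.span (u ` M) \<Longrightarrow> herm s (r i) = 0"
    and r_le: "\<And>i. i \<in> M \<Longrightarrow> norm (r i) \<le> \<tau>"
  shows "max_principal_angle (vec.span (f ` M)) (vec.span (u ` M)) \<le> pi * L * \<tau>"
proof -
  have "max_principal_angle (vec.span (f ` M)) (vec.span (u ` M)) \<le> pi / 2 * (2 * L * \<tau>)"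
  proof (rule max_principal_angle_le_dist)
    fix v assume v: "v \<in> vec.span (f ` M)" "norm v = 1"
    obtain c where c: "v = (\<Sum>i\<in>M. c i *s f i)"
      using span_image_finite_sum[OF _ v(1)] by auto
    define p where "p = (\<Sum>j\<in>M. (\<Sum>i\<in>M. c i * A i j) *s u j)"
    define s where "s = (\<Sum>i\<in>M. c i *s r i)"
    have vps: "v = p + s"
    proof -
      have "v = (\<Sum>i\<in>M. c i *s (\<Sum>j\<in>M. A i j *s u j)) + s"
        by (simp add: c f vec.scale_right_distrib sum.distrib s_def)
      also have "(\<Sum>i\<in>M. c i *s (\<Sum>j\<in>M. A i j *s u j)) = p"
        unfolding p_def vec.scale_sum_right vec.scale_sum_left vec.scale_scale by (rule sum.swap)
      finally show ?thesis .
    qed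
    have p: "p \<in> vec.span (u ` M)"
      unfolding p_def by (intro vec.span_sum vec.span_scale vec.span_base) auto
    have s: "herm b s = 0" if "b \<in> vec.span (u ` M)" for b
      using r that by (simp add: s_def herm_sum_right herm_scale_right)
    have "norm p \<le> 1"
    proof (rule power2_le_imp_le)
      have "(norm p)\<^sup>2 + (norm s)\<^sup>2 = 1\<^sup>2"
        using norm_add_orthogonal[OF s[OF p]] vps v(2) by simp
      then show "(norm p)\<^sup>2 \<le> 1\<^sup>2"
        using zero_le_power2[of "norm s"] by linarith
    qed simp
    moreover have "(\<Sum>i\<in>M. cmod (c i)) \<le> 2 * (\<Sum>j\<in>M. cmod (\<Sum>i\<in>M. c i * A i j))"
      by (rule near_identity_coefficients[OF _ \<eta> A]) simp_all
    ultimately have "(\<Sum>i\<in>M. cmod (c i)) \<le> 2 * L"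
      using L(2)[of "\<lambda>j. \<Sum>i\<in>M. c i * A i j"] mult_left_mono[of "norm p" 1 L] L(1)
      unfolding p_def[symmetric] by linarith
    moreover have "norm s \<le> (\<Sum>i\<in>M. cmod (c i) * \<tau>)"
      unfolding s_def by (intro sum_norm_le) (simp add: norm_scale mult_left_mono r_le)
    ultimately have "norm s \<le> 2 * L * \<tau>"
      using mult_right_mono[OF _ \<tau>] by (fastforce simp: sum_distrib_right[symmetric])
    with vps p s show "\<exists>p r. v = p + r \<and> p \<in> vec.span (u ` M)
        \<and> (\<forall>s\<in>vec.span (u ` M). herm s r = 0) \<and> norm r \<le> 2 * L * \<tau>"
      by blast
  qed (use L(1) \<tau> in simp_all)
  then show ?thesis by (simp add: mult.assoc)
qed

section \<open>One step of the filtered subspace iteration\<close>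

theorem theorem6:
  fixes D \<Omega> :: "complex set"
    and T :: "complex \<Rightarrow> complex^'n^'n"
    and M :: "'n set"
    and lam :: "'n \<Rightarrow> complex"
    and u w :: "'n \<Rightarrow> complex^'n"
    and K_ext K_filt :: real
  assumes "D \<noteq> {}" and "jordan_domain D"
    and "open \<Omega>" and "connected \<Omega>" and "closure D \<subseteq> \<Omega>"
    and "holomorphic_matrix_on T \<Omega>"
    and "\<exists>\<xi>\<in>D. det (T \<xi>) \<noteq> 0"
    and "inj_on lam M" and "lam ` M = eigenvalues_in T D"
    and "\<And>i. i \<in> M \<Longrightarrow> simple_eigenvalue T (lam i)"
    and "\<And>i. i \<in> M \<Longrightarrow> eigenpair T (lam i) (u i) \<and> norm (u i) = 1"
    and "inj_on u M" and "vec.independent (u ` M)"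
    and "orthonormal_complement_basis (vec.span (u ` M)) (- M) w"
  shows "\<exists>\<epsilon>0 C. 0 < \<epsilon>0 \<and> \<epsilon>0 < pi / 2 \<and>
    (\<forall>\<epsilon>T R V \<pi> F \<gamma>.
        0 < \<epsilon>T \<and> \<epsilon>T \<le> \<epsilon>0
        \<and> extraction_procedure D M R V
        \<and> extraction_assumption M lam u K_ext \<epsilon>T R V \<pi>
        \<and> (\<forall>N\<ge>1. 0 \<le> \<gamma> N) \<and> \<gamma> \<longlonglongrightarrow> 0
        \<and> filter_bounds M u w K_filt \<epsilon>T R V \<pi> F \<gamma>
      \<longrightarrow> (\<exists>N0\<ge>1. \<forall>N\<ge>N0. \<forall>X \<rho> x.
            admissible (vec.span (u ` M)) (card M) \<epsilon>T X \<and> normalized_pairs M u w R V \<pi> X \<rho> x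
            \<longrightarrow> max_principal_angle (vec.span ((\<lambda>i. F N (\<rho> i) *v x i) ` M)) (vec.span (u ` M))
                  \<le> C * (\<gamma> N * max_principal_angle X (vec.span (u ` M)))))"
proof -
  let ?U = "vec.span (u ` M)"
  obtain L where L: "0 < L" "\<And>a. (\<Sum>j\<in>M. cmod (a j)) \<le> L * norm (\<Sum>j\<in>M. a j *s u j)"
    using coefficients_bounded_by_norm[OF assms(12,13)] by blast
  have ww: "\<And>j k. j \<in> - M \<Longrightarrow> k \<in> - M \<Longrightarrow> herm (w j) (w k) = (if j = k then 1 else 0)"
    and wU: "vec.span (w ` (- M)) = {v. \<forall>s\<in>?U. herm s v = 0}"
    using assms(14) unfolding orthonormal_complement_basis_def by auto
  \<comment> \<open>\<open>K_filt\<close> may be negative, and \<open>K\<close> has to serve as a nonnegative factor.\<close>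
  define K where "K = \<bar>K_filt\<bar>"
  define m where "m = real (card M)"
  \<comment> \<open>With \<open>\<gamma> N\<close> and \<open>\<epsilon>\<close> both at most \<open>\<epsilon>0\<close>, the condition \<open>m * K * (\<gamma> N + \<epsilon>) \<le> 1 / 2\<close> of diagonal
    dominance holds; adding 1 avoids division by zero and keeps \<open>\<epsilon>0\<close> below \<open>\<pi>/2\<close>.\<close>
  define \<epsilon>0 where "\<epsilon>0 = 1 / (4 * (m * K + 1))"
  have K: "0 \<le> K" "K_filt \<le> K" and m: "0 \<le> m" by (auto simp: K_def m_def)
  then have mK: "0 \<le> m * K" by simp
  have \<epsilon>0: "0 < \<epsilon>0" "\<epsilon>0 \<le> 1 / 4" "m * K * \<epsilon>0 \<le> 1 / 4"
    using mK by (auto simp: \<epsilon>0_def field_simps)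
  show ?thesis
  proof (rule exI[of _ \<epsilon>0], rule exI[of _ "pi * L * K"], intro conjI allI impI)
    show "0 < \<epsilon>0" by fact
    show "\<epsilon>0 < pi / 2" using \<epsilon>0(2) pi_gt3 by simp
  next
    fix \<epsilon>T R V \<pi> F \<gamma>
    assume asm: "0 < \<epsilon>T \<and> \<epsilon>T \<le> \<epsilon>0
        \<and> extraction_procedure D M R V
        \<and> extraction_assumption M lam u K_ext \<epsilon>T R V \<pi>
        \<and> (\<forall>N\<ge>1. 0 \<le> \<gamma> N) \<and> \<gamma> \<longlonglongrightarrow> 0
        \<and> filter_bounds M u w K_filt \<epsilon>T R V \<pi> F \<gamma>"
    then have "\<forall>\<^sub>F N in sequentially. \<gamma> N < \<epsilon>0"
      using \<epsilon>0(1) by (intro order_tendstoD) auto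
    then obtain N1 where N1: "\<And>N. N \<ge> N1 \<Longrightarrow> \<gamma> N < \<epsilon>0"
      by (auto simp: eventually_sequentially)
    show "\<exists>N0\<ge>1. \<forall>N\<ge>N0. \<forall>X \<rho> x.
            admissible ?U (card M) \<epsilon>T X \<and> normalized_pairs M u w R V \<pi> X \<rho> x
            \<longrightarrow> max_principal_angle (vec.span ((\<lambda>i. F N (\<rho> i) *v x i) ` M)) ?U
                  \<le> pi * L * K * (\<gamma> N * max_principal_angle X ?U)"
    proof (intro exI[of _ "max 1 N1"] conjI allI impI)
      fix N X \<rho> x
      assume "max 1 N1 \<le> N"
        and X: "admissible ?U (card M) \<epsilon>T X \<and> normalized_pairs M u w R V \<pi> X \<rho> x"
      then have N: "1 \<le> N" and \<gamma>: "0 \<le> \<gamma> N" "\<gamma> N \<le> \<epsilon>0" using N1[of N] asm by auto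
      define \<epsilon> where "\<epsilon> = max_principal_angle X ?U"
      have \<epsilon>: "0 \<le> \<epsilon>" "\<epsilon> \<le> \<epsilon>0"
        using X asm by (auto simp: \<epsilon>_def admissible_def intro!: max_principal_angle_nonneg)
      define \<eta> where "\<eta> = K * (\<gamma> N + \<epsilon>)"
      have "\<forall>i\<in>M. \<exists>\<alpha> y z.
            F N (\<rho> i) *v x i
              = \<alpha> *s u i + (\<Sum>j\<in>M - {i}. y j *s u j) + (\<Sum>j\<in>- M. z j *s w j)
          \<and> cmod (\<alpha> - 1) \<le> K_filt * (\<gamma> N + \<epsilon>)
          \<and> L2_set (\<lambda>j. cmod (y j)) (M - {i}) \<le> K_filt * (\<gamma> N + \<epsilon>)
          \<and> L2_set (\<lambda>j. cmod (z j)) (- M) \<le> K_filt * (\<gamma> N * \<epsilon>)"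
        using asm X N unfolding filter_bounds_def Let_def \<epsilon>_def by blast
      then obtain \<alpha> y z where
        dec: "\<And>i. i \<in> M \<Longrightarrow> F N (\<rho> i) *v x i
              = \<alpha> i *s u i + (\<Sum>j\<in>M - {i}. y i j *s u j) + (\<Sum>j\<in>- M. z i j *s w j)"
        and \<alpha>: "\<And>i. i \<in> M \<Longrightarrow> cmod (\<alpha> i - 1) \<le> K_filt * (\<gamma> N + \<epsilon>)"
        and y: "\<And>i. i \<in> M \<Longrightarrow> L2_set (\<lambda>j. cmod (y i j)) (M - {i}) \<le> K_filt * (\<gamma> N + \<epsilon>)"
        and z: "\<And>i. i \<in> M \<Longrightarrow> L2_set (\<lambda>j. cmod (z i j)) (- M) \<le> K_filt * (\<gamma> N * \<epsilon>)"
        unfolding bchoice_iff by blast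
      have K_filt_le: "K_filt * (\<gamma> N + \<epsilon>) \<le> \<eta>" "K_filt * (\<gamma> N * \<epsilon>) \<le> K * (\<gamma> N * \<epsilon>)"
        unfolding \<eta>_def using K(2) \<gamma>(1) \<epsilon>(1) by (auto intro!: mult_right_mono)
      define A where "A i j = (if j = i then \<alpha> i else y i j)" for i j
      define r where "r i = (\<Sum>j\<in>- M. z i j *s w j)" for i
      have "max_principal_angle (vec.span ((\<lambda>i. F N (\<rho> i) *v x i) ` M)) ?U
          \<le> pi * L * (K * (\<gamma> N * \<epsilon>))"
      proof (rule perturbed_basis_angle[OF L, where A = A and r = r and \<eta> = \<eta>])
        have "m * \<eta> = m * K * \<gamma> N + m * K * \<epsilon>" by (simp add: \<eta>_def algebra_simps)
        also have "\<dots> \<le> m * K * \<epsilon>0 + m * K * \<epsilon>0"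
          using mK \<gamma> \<epsilon> by (intro add_mono mult_left_mono) auto
        finally show "real (card M) * \<eta> \<le> 1 / 2" using \<epsilon>0(3) unfolding m_def by linarith
        show "0 \<le> K * (\<gamma> N * \<epsilon>)" using K \<gamma> \<epsilon> by simp
        fix i assume i: "i \<in> M"
        show "cmod (A i j - (if i = j then 1 else 0)) \<le> \<eta>" if "j \<in> M" for j
        proof (cases "j = i")
          case True
          then show ?thesis using \<alpha>[OF i] K_filt_le by (simp add: A_def)
        next
          case False
          then have "cmod (y i j) \<le> L2_set (\<lambda>j. cmod (y i j)) (M - {i})"
            using that by (intro member_le_L2_set) auto
          then show ?thesis using y[OF i] K_filt_le False by (simp add: A_def)
        qed
        have "(\<Sum>j\<in>M. A i j *s u j) = \<alpha> i *s u i + (\<Sum>j\<in>M - {i}. y i j *s u j)"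
          using i by (subst sum.remove[of M i]) (auto simp: A_def intro!: sum.cong)
        then show "F N (\<rho> i) *v x i = (\<Sum>j\<in>M. A i j *s u j) + r i"
          using dec[OF i] by (simp add: r_def)
        have "r i \<in> vec.span (w ` (- M))"
          unfolding r_def by (intro vec.span_sum vec.span_scale vec.span_base) auto
        then show "herm s (r i) = 0" if "s \<in> ?U" for s using wU that by auto
        show "norm (r i) \<le> K * (\<gamma> N * \<epsilon>)"
          unfolding r_def using z[OF i] K_filt_le by (subst norm_orthonormal_sum) (auto simp: ww)
      qed
      then show "max_principal_angle (vec.span ((\<lambda>i. F N (\<rho> i) *v x i) ` M)) ?U
          \<le> pi * L * K * (\<gamma> N * max_principal_angle X ?U)"
        by (simp add: \<epsilon>_def mult.assoc)
    qed simp
  qed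
qed

end
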